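(* Let $r\ge 0$ be an integer. Define the sequence $\{h_r(n)\}_{n\ge 0}$ by $$h_r(n)=\begin{cases}\dfrac{H_{2n}-H_{n+r}}{n-r} & \text{if } n\ne r,\\[2mm] \dfrac{\pi^2}{6}-\displaystyle\sum_{1\le k\le 2r}\frac1{k^2} & \text{if } n=r.\end{cases}$$ Then $$\sum_{n=0}^{+\infty}c_n h_r(n)=\frac{1}{r+1}.$$
   Context: $H_m=1+\frac12+\ldots+\frac1m$ is the $m$-th harmonic number, with $H_0=0$; empty sums are $0$. Let $\mathcal H=L^2([0,1],dx)$ (complex-valued functions, Lebesgue measure) with its norm $\|\cdot\|$. The sequence $(c_n)_{n\ge 0}$ is defined recursively: $c_0=1$, and, writing $p_n(x)=c_0+c_1x+\ldots+c_nx^n$, for each $n\ge 0$ the number $c_{n+1}$ is the unique complex number $c$ for which the norm $\|p_n(x)+c\,x^{n+1}\|$ is minimal among all $c\in\mathbb C$. Equivalently, $c_0=1$ and $\frac{c_0}{n+1}+\frac{c_1}{n+2}+\ldots+\frac{c_n}{2n+1}=0$ for all $n\ge 1$. *)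

theory Defs
  imports "HOL-Analysis.Analysis"
begin

definition L2_norm01 :: "(real \<Rightarrow> complex) \<Rightarrow> real" where
  "L2_norm01 f = sqrt (LINT x:{0..1}|lebesgue. (cmod (f x))\<^sup>2)"

text \<open>
  The minimiser exists and is unique because \<open>x ^ Suc n\<close> has nonzero norm; thus
  the description operator below denotes it.
\<close>

fun opt_coeff :: "nat \<Rightarrow> complex" where
  "opt_coeff 0 = 1"
| "opt_coeff (Suc n) =
     (THE z. is_arg_min
       (\<lambda>z. L2_norm01 (\<lambda>x. (\<Sum>k\<le>n. opt_coeff k * of_real x ^ k) + z * of_real x ^ Suc n))
       (\<lambda>_. True) z)"

definition h_seq :: "nat \<Rightarrow> nat \<Rightarrow> real" where
  "h_seq r n =
     (if n \<noteq> r then (harm (2 * n) - harm (n + r)) / (real n - real r)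
      else pi\<^sup>2 / 6 - (\<Sum>k=1..2 * r. 1 / (real k)\<^sup>2))"

end

theory Submission
  imports Defs
begin

text \<open>
  The value \<open>h\<^sub>r(n)\<close> is the series \<open>\<Sum>m\<ge>n. 1 / ((m + n + 1) (m + r + 1))\<close>. Interchanging the order
  of summation in \<open>\<Sum>n. c\<^sub>n h\<^sub>r(n)\<close> produces the inner sums \<open>\<Sum>n\<le>m. c\<^sub>n / (m + n + 1)\<close>, which are
  the inner products of \<open>p\<^sub>m\<close> with \<open>x^m\<close> and vanish for \<open>m \<ge> 1\<close> by minimality, so that only the
  term \<open>1 / (r + 1)\<close> for \<open>m = 0\<close> remains. Truncating the outer sum at \<open>N\<close> leaves the error
  \<open>\<Sum>m>N. \<langle>p\<^sub>N, x^m\<rangle> / (m + r + 1)\<close>; as \<open>\<parallel>p\<^sub>N\<parallel> \<le> \<parallel>p\<^sub>0\<parallel> = 1\<close> and \<open>\<parallel>x^m\<parallel> = 1 / sqrt (2 m + 1)\<close>, it is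
  bounded by a tail of a convergent series.
\<close>

declare opt_coeff.simps(2) [simp del]

section \<open>Adding a multiple of a monomial in the L2 norm\<close>

text \<open>Continuity makes the Lebesgue integral in \<open>L2_norm01\<close> agree with the gauge
  integral, so that the \<open>has_integral\<close> calculus applies to norms.\<close>

lemma L2_norm01_power2_has_integral:
  assumes "continuous_on {0..1} f"
  shows "((\<lambda>x. (cmod (f x))\<^sup>2) has_integral (L2_norm01 f)\<^sup>2) {0..1}"
proof -
  have "continuous_on {0..1} (\<lambda>x. (cmod (f x))\<^sup>2)"
    by (intro continuous_intros assms)
  then have abs: "(\<lambda>x. (cmod (f x))\<^sup>2) absolutely_integrable_on {0..1}"
    by (rule absolutely_integrable_continuous_real)
  have "(L2_norm01 f)\<^sup>2 = (LINT x:{0..1}|lebesgue. (cmod (f x))\<^sup>2)"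
    unfolding L2_norm01_def set_lebesgue_integral_def
    by (intro real_sqrt_pow2 Bochner_Integration.integral_nonneg) simp
  then show ?thesis
    using set_lebesgue_integral_eq_integral[OF abs] by (simp add: has_integral_iff)
qed

lemma power_has_integral_01: "((\<lambda>x::real. x ^ m) has_integral 1 / (real m + 1)) {0..1}"
proof -
  have "((\<lambda>x::real. x ^ m) has_integral (1 ^ Suc m / real (Suc m) - 0 ^ Suc m / real (Suc m))) {0..1}"
    by (rule fundamental_theorem_of_calculus)
      (auto intro!: derivative_eq_intros
        simp flip: has_real_derivative_iff_has_vector_derivative simp del: of_nat_Suc power_Suc)
  then show ?thesis by (simp add: add.commute)
qed

text \<open>Completing the square in \<open>z\<close>: \<open>a\<close> is the inner product of
  \<open>f\<close> with \<open>x ^ m\<close>, and \<open>1 / M\<close> is the squared norm of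
  \<open>x ^ m\<close>. Only the last summand depends on \<open>z\<close>.\<close>

lemma L2_norm01_add_monomial:
  assumes cont: "continuous_on {0..1} f"
    and a: "((\<lambda>x. f x * of_real x ^ m) has_integral a) {0..1}"
  defines "M \<equiv> 2 * real m + 1"
  shows "(L2_norm01 (\<lambda>x. f x + z * of_real x ^ m))\<^sup>2
    = (L2_norm01 f)\<^sup>2 - M * (cmod a)\<^sup>2 + (cmod (z + of_real M * a))\<^sup>2 / M"
proof -
  have Re: "((\<lambda>x. Re (cnj z * (f x * of_real x ^ m))) has_integral Re (cnj z * a)) {0..1}"
    by (intro has_integral_Re has_integral_mult_right a)
  have "((\<lambda>x. (cmod (f x))\<^sup>2 + 2 * Re (cnj z * (f x * of_real x ^ m)) + (cmod z)\<^sup>2 * x ^ (2 * m))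
      has_integral (L2_norm01 f)\<^sup>2 + 2 * Re (cnj z * a) + (cmod z)\<^sup>2 * (1 / (real (2 * m) + 1))) {0..1}"
    by (intro has_integral_add has_integral_mult_right L2_norm01_power2_has_integral cont Re
        power_has_integral_01)
  also have "(\<lambda>x. (cmod (f x))\<^sup>2 + 2 * Re (cnj z * (f x * of_real x ^ m)) + (cmod z)\<^sup>2 * x ^ (2 * m))
      = (\<lambda>x. (cmod (f x + z * of_real x ^ m))\<^sup>2)"
    by (intro ext)
      (simp add: cmod_power2 flip: of_real_power, simp add: power_mult power2_eq_square algebra_simps)
  finally have "((\<lambda>x. (cmod (f x + z * of_real x ^ m))\<^sup>2)
    has_integral (L2_norm01 f)\<^sup>2 + 2 * Re (cnj z * a) + (cmod z)\<^sup>2 / M) {0..1}"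
    by (simp add: M_def)
  moreover have "((\<lambda>x. (cmod (f x + z * of_real x ^ m))\<^sup>2)
    has_integral (L2_norm01 (\<lambda>x. f x + z * of_real x ^ m))\<^sup>2) {0..1}"
    by (intro L2_norm01_power2_has_integral continuous_intros cont)
  ultimately have "(L2_norm01 (\<lambda>x. f x + z * of_real x ^ m))\<^sup>2
      = (L2_norm01 f)\<^sup>2 + 2 * Re (cnj z * a) + (cmod z)\<^sup>2 / M"
    by (rule has_integral_unique[rotated])
  moreover have "M > 0" by (simp add: M_def)
  then have "(cmod (z + of_real M * a))\<^sup>2 / M = (cmod z)\<^sup>2 / M + 2 * Re (cnj z * a) + M * (cmod a)\<^sup>2"
    by (simp add: cmod_power2, simp add: field_simps power2_eq_square)
  ultimately show ?thesis by simp
qed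

text \<open>The Cauchy-Schwarz inequality, read off from the completed square at the
  \<open>z\<close> that annihilates its last summand, since the left-hand side there is still
  nonnegative.\<close>

lemma inner_monomial_bound:
  assumes "continuous_on {0..1} f"
    and "((\<lambda>x. f x * of_real x ^ m) has_integral a) {0..1}"
  shows "(2 * real m + 1) * (cmod a)\<^sup>2 \<le> (L2_norm01 f)\<^sup>2"
  using L2_norm01_add_monomial[OF assms, of "- (of_real (2 * real m + 1) * a)"]
    zero_le_power2[of "L2_norm01 (\<lambda>x. f x + - (of_real (2 * real m + 1) * a) * of_real x ^ m)"]
  by simp

lemma L2_norm01_nonneg: "L2_norm01 f \<ge> 0"
  unfolding L2_norm01_def set_lebesgue_integral_def
  by (intro real_sqrt_ge_zero Bochner_Integration.integral_nonneg) simp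

lemma arg_min_L2_norm01_add_monomial:
  assumes "continuous_on {0..1} f"
    and "((\<lambda>x. f x * of_real x ^ m) has_integral a) {0..1}"
  shows "(THE z. is_arg_min (\<lambda>z. L2_norm01 (\<lambda>x. f x + z * of_real x ^ m)) (\<lambda>_. True) z)
    = - (of_real (2 * real m + 1) * a)" (is "_ = ?w")
proof -
  define F where "F z = L2_norm01 (\<lambda>x. f x + z * of_real x ^ m)" for z
  define w where "w = ?w"
  have w_zero: "w + of_real (2 * real m + 1) * a = 0"
    by (simp add: w_def)
  \<comment> \<open>At \<open>w\<close> the completed square vanishes, so the part free of
    \<open>z\<close> is the squared value at \<open>w\<close>. Strictness of the minimum
    follows.\<close>
  have eq: "(F z)\<^sup>2 = (F w)\<^sup>2 + (cmod (z - w))\<^sup>2 / (2 * real m + 1)" for z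
    unfolding F_def L2_norm01_add_monomial[OF assms] w_zero by (simp add: w_def)
  have less: "F w < F z" if "z \<noteq> w" for z
  proof (rule power_less_imp_less_base)
    have "(cmod (z - w))\<^sup>2 / (2 * real m + 1) > 0"
      using that by (intro divide_pos_pos) auto
    with eq[of z] show "(F w)\<^sup>2 < (F z)\<^sup>2" by linarith
  qed (simp add: F_def L2_norm01_nonneg)
  have "(THE z. is_arg_min F (\<lambda>_. True) z) = w"
  proof (rule the_equality)
    have "\<not> F z < F w" for z
      using less[of z] by (cases "z = w") auto
    then show "is_arg_min F (\<lambda>_. True) w"
      by (simp add: is_arg_min_def)
    show "z = w" if "is_arg_min F (\<lambda>_. True) z" for z
      using that less[of z] by (auto simp: is_arg_min_def)
  qed
  then show ?thesis
    by (simp only: F_def[abs_def] w_def)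
qed

section \<open>Orthogonality and norm bound for the optimal polynomials\<close>

definition opt_poly :: "nat \<Rightarrow> real \<Rightarrow> complex" where
  "opt_poly n x = (\<Sum>k\<le>n. opt_coeff k * of_real x ^ k)"

lemma continuous_on_opt_poly: "continuous_on A (opt_poly n)"
  unfolding opt_poly_def by (intro continuous_intros)

lemma opt_poly_Suc: "opt_poly (Suc n) = (\<lambda>x. opt_poly n x + opt_coeff (Suc n) * of_real x ^ Suc n)"
  by (rule ext) (simp add: opt_poly_def)

lemma opt_poly_inner_monomial:
  "((\<lambda>x. opt_poly n x * of_real x ^ m) has_integral
    (\<Sum>k\<le>n. opt_coeff k / of_nat (m + k + 1))) {0..1}"
proof -
  have "((\<lambda>x. opt_coeff k * of_real (x ^ (m + k))) has_integral
      opt_coeff k * of_real (1 / (real (m + k) + 1))) {0..1}" for k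
    by (intro has_integral_mult_right has_integral_of_real power_has_integral_01)
  then have "((\<lambda>x. \<Sum>k\<le>n. opt_coeff k * of_real (x ^ (m + k))) has_integral
      (\<Sum>k\<le>n. opt_coeff k * of_real (1 / (real (m + k) + 1)))) {0..1}"
    by (intro has_integral_sum) auto
  then show ?thesis
    by (simp add: opt_poly_def sum_distrib_left power_add mult_ac add_ac)
qed

text \<open>Trades the description operator for an explicit recursion; the factor is
  \<open>2 * Suc n + 1\<close>.\<close>

lemma opt_coeff_Suc:
  "opt_coeff (Suc n) = - (of_nat (2 * n + 3) * (\<Sum>k\<le>n. opt_coeff k / of_nat (Suc n + k + 1)))"
proof -
  have "opt_coeff (Suc n) = - (of_real (2 * real (Suc n) + 1) * (\<Sum>k\<le>n. opt_coeff k / of_nat (Suc n + k + 1)))"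
    using arg_min_L2_norm01_add_monomial[OF continuous_on_opt_poly opt_poly_inner_monomial[of n "Suc n"]]
    by (simp add: opt_poly_def opt_coeff.simps(2))
  then show ?thesis by (simp add: algebra_simps)
qed

text \<open>For \<open>m = Suc n\<close> the last summand has denominator \<open>2 * n + 3\<close>,
  the factor in \<open>opt_coeff_Suc\<close>, and so cancels the others.\<close>

lemma opt_poly_orthogonal:
  "(\<Sum>k\<le>m. opt_coeff k / of_nat (m + k + 1)) = (if m = 0 then 1 else 0)"
proof (cases m)
  case (Suc n)
  have "(of_nat (2 * n + 3) :: complex) \<noteq> 0"
    by (simp only: of_nat_eq_0_iff)
  then have "opt_coeff (Suc n) / of_nat (2 * n + 3) = - (\<Sum>k\<le>n. opt_coeff k / of_nat (Suc n + k + 1))"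
    unfolding opt_coeff_Suc by (simp del: of_nat_add of_nat_mult of_nat_Suc)
  moreover have "Suc n + Suc n + 1 = 2 * n + 3" by simp
  ultimately show ?thesis
    unfolding Suc by (simp only: sum.atMost_Suc) simp
qed simp

text \<open>The optimal coefficient annihilates the completed square, so each step can only lower
  the norm, which starts at 1.\<close>

lemma L2_norm01_opt_poly_le: "(L2_norm01 (opt_poly n))\<^sup>2 \<le> 1"
proof (induction n)
  case 0
  have "((\<lambda>x. (cmod (opt_poly 0 x))\<^sup>2) has_integral 1) {0..1}"
    using power_has_integral_01[of 0] by (simp add: opt_poly_def)
  then show ?case
    using has_integral_unique[OF L2_norm01_power2_has_integral[OF continuous_on_opt_poly[of _ 0]]]
    by auto
next
  case (Suc n)
  let ?a = "\<Sum>k\<le>n. opt_coeff k / of_nat (Suc n + k + 1)"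
  have norm_eq: "(L2_norm01 (opt_poly (Suc n)))\<^sup>2
      = (L2_norm01 (opt_poly n))\<^sup>2 - (2 * real (Suc n) + 1) * (cmod ?a)\<^sup>2
        + (cmod (opt_coeff (Suc n) + of_real (2 * real (Suc n) + 1) * ?a))\<^sup>2 / (2 * real (Suc n) + 1)"
    unfolding opt_poly_Suc
    by (rule L2_norm01_add_monomial[OF continuous_on_opt_poly opt_poly_inner_monomial])
  have zero: "opt_coeff (Suc n) + of_real (2 * real (Suc n) + 1) * ?a = 0"
    unfolding opt_coeff_Suc by (simp add: algebra_simps)
  have "(2 * real (Suc n) + 1) * (cmod ?a)\<^sup>2 \<ge> 0"
    by simp
  with Suc show ?case
    unfolding norm_eq zero norm_zero zero_power2 div_0 by linarith
qed

lemma opt_poly_inner_bound: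
  "cmod (\<Sum>k\<le>n. opt_coeff k / of_nat (m + k + 1)) \<le> real (Suc m) powr (-1/2)"
    (is "cmod ?a \<le> _")
proof -
  have "real (Suc m) * (cmod ?a)\<^sup>2 \<le> (2 * real m + 1) * (cmod ?a)\<^sup>2"
    by (intro mult_right_mono) auto
  also have "\<dots> \<le> 1"
    using inner_monomial_bound[OF continuous_on_opt_poly opt_poly_inner_monomial[of n m]]
      L2_norm01_opt_poly_le[of n] by linarith
  finally have "(cmod ?a)\<^sup>2 \<le> 1 / real (Suc m)"
    by (simp add: field_simps)
  also have "\<dots> = (real (Suc m) powr (-1/2))\<^sup>2"
    by (simp add: power2_eq_square powr_neg_one flip: powr_add)
  finally show ?thesis
    by (rule power2_le_imp_le) simp
qed

section \<open>Series representation of \<open>h_seq\<close>\<close>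

lemma harm_add_diff_tendsto_0: "(\<lambda>N. harm (N + a) - harm N :: real) \<longlonglongrightarrow> 0"
proof (induction a)
  case (Suc a)
  have "(\<lambda>N. inverse (real (Suc (N + a)))) \<longlonglongrightarrow> 0"
    by (rule LIMSEQ_ignore_initial_segment[OF LIMSEQ_inverse_real_of_nat])
  from tendsto_add[OF Suc this] show ?case
    by (simp add: harm_Suc algebra_simps)
qed simp

text \<open>For \<open>n = r\<close> this is the Basel series without its first \<open>2 * r\<close>
  terms; otherwise partial fractions make it telescope.\<close>

lemma h_seq_sums:
  "(\<lambda>j. 1 / (real (j + 2 * n + 1) * real (j + n + r + 1))) sums h_seq r n"
proof (cases "n = r")
  case True
  have "(\<lambda>j. 1 / (real j + 1)\<^sup>2) sums (pi\<^sup>2 / 6)"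
    using inverse_squares_sums by (simp add: add_ac)
  from sums_split_initial_segment[OF this, of "2 * r"]
  have "(\<lambda>j. 1 / (real (j + 2 * r) + 1)\<^sup>2) sums (pi\<^sup>2 / 6 - (\<Sum>k<2*r. 1 / (real k + 1)\<^sup>2))"
    by simp
  also have "(\<Sum>k<2*r. 1 / (real k + 1)\<^sup>2) = (\<Sum>k=1..2*r. 1 / (real k)\<^sup>2)"
    by (rule sum.reindex_bij_witness[of _ "\<lambda>k. k - 1" Suc]) (auto simp: add_ac)
  also have "(\<lambda>j. 1 / (real (j + 2 * r) + 1)\<^sup>2)
      = (\<lambda>j. 1 / (real (j + 2 * n + 1) * real (j + n + r + 1)))"
    using True by (simp add: power2_eq_square add_ac)
  finally show ?thesis
    using True by (simp add: h_seq_def)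
next
  case False
  define d where "d = real n - real r"
  have "d \<noteq> 0" using False by (simp add: d_def)
  have fraction: "1 / (x * y) = (inverse y - inverse x) / d" if "x > 0" "y > 0" "d = x - y" for x y
  proof -
    have "inverse y - inverse x = d * (1 / (x * y))"
      using that by (simp add: field_simps)
    then show ?thesis using \<open>d \<noteq> 0\<close> by simp
  qed
  \<comment> \<open>The divergent \<open>harm J\<close> is subtracted twice, with cancelling signs,
    so that both differences depending on \<open>J\<close> tend to 0.\<close>
  have partial: "(\<Sum>j<J. 1 / (real (j + 2 * n + 1) * real (j + n + r + 1)))
      = (harm (2 * n) - harm (n + r)
          + ((harm (J + (n + r)) - harm J) - (harm (J + 2 * n) - harm J))) / d" for J
  proof (induction J)
    case (Suc J)
    have "1 / (real (J + 2 * n + 1) * real (J + n + r + 1))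
      = (inverse (real (Suc (J + (n + r)))) - inverse (real (Suc (J + 2 * n)))) / d"
      using fraction[of "real (J + 2 * n + 1)" "real (J + n + r + 1)"] by (simp add: d_def add_ac)
    then show ?case
      unfolding sum.lessThan_Suc Suc add_Suc harm_Suc
      by (simp only: add_divide_distrib diff_divide_distrib)
  qed simp
  have "(\<lambda>J. (harm (2 * n) - harm (n + r)
          + ((harm (J + (n + r)) - harm J) - (harm (J + 2 * n) - harm J))) / d)
      \<longlonglongrightarrow> (harm (2 * n) - harm (n + r) + (0 - 0)) / d"
    by (intro tendsto_intros harm_add_diff_tendsto_0 \<open>d \<noteq> 0\<close>)
  then show ?thesis
    unfolding sums_def partial using False by (simp add: h_seq_def d_def)
qed

text \<open>Padding with zeros gives all \<open>n\<close> the common index \<open>m\<close>, so that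
  finitely many of these series can be added termwise.\<close>

lemma h_seq_sums_from:
  "(\<lambda>m. if n \<le> m then 1 / (real (m + n + 1) * real (m + r + 1)) else 0) sums h_seq r n"
proof -
  let ?f = "\<lambda>m. if n \<le> m then 1 / (real (m + n + 1) * real (m + r + 1)) else 0"
  have "(\<lambda>j. ?f (j + n)) sums h_seq r n"
    using h_seq_sums[of n r] by (simp add: add_ac)
  then show ?thesis
    by (subst (asm) sums_zero_iff_shift) auto
qed

section \<open>The truncation error and its limit\<close>

lemma partial_sum_error:
  "(\<lambda>j. (\<Sum>k\<le>N. opt_coeff k / of_nat (j + Suc N + k + 1)) / of_nat (j + Suc N + r + 1)) sums
    ((\<Sum>n\<le>N. opt_coeff n * of_real (h_seq r n)) - 1 / (of_nat r + 1))"
proof -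
  define T where "T m = (\<Sum>n\<le>N. opt_coeff n *
    of_real (if n \<le> m then 1 / (real (m + n + 1) * real (m + r + 1)) else 0))" for m
  have T_large: "T m = (\<Sum>k\<le>N. opt_coeff k / of_nat (m + k + 1)) / of_nat (m + r + 1)" if "m \<ge> N" for m
    unfolding T_def sum_divide_distrib using that by (intro sum.cong) auto
  have T_small: "T m = (if m = 0 then 1 / (of_nat r + 1) else 0)" if "m \<le> N" for m
  proof -
    \<comment> \<open>The padding removes the summands with \<open>n > m\<close>, leaving a complete
      orthogonality sum.\<close>
    have "T m = (\<Sum>k\<le>m. opt_coeff k / of_nat (m + k + 1) / of_nat (m + r + 1))"
      unfolding T_def using that by (intro sum.mono_neutral_cong_right) auto
    also have "\<dots> = (\<Sum>k\<le>m. opt_coeff k / of_nat (m + k + 1)) / of_nat (m + r + 1)"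
      by (rule sum_divide_distrib[symmetric])
    finally show ?thesis
      unfolding opt_poly_orthogonal by (simp add: add_ac)
  qed
  have "T sums (\<Sum>n\<le>N. opt_coeff n * of_real (h_seq r n))"
    unfolding T_def by (intro sums_sum sums_mult sums_of_real h_seq_sums_from)
  from sums_split_initial_segment[OF this, of "Suc N"]
  have "(\<lambda>j. T (j + Suc N)) sums ((\<Sum>n\<le>N. opt_coeff n * of_real (h_seq r n)) - (\<Sum>m<Suc N. T m))" .
  also have "(\<Sum>m<Suc N. T m) = (\<Sum>m<Suc N. if m = 0 then 1 / (of_nat r + 1) else 0)"
    by (intro sum.cong) (auto simp: T_small)
  also have "\<dots> = 1 / (of_nat r + 1)"
    by simp
  finally show ?thesis
    by (simp add: T_large)
qed

text \<open>The factor \<open>1 / (m + r + 1)\<close> lifts the decay exponent from 1/2 to 3/2,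
  hence to a summable bound.\<close>

lemma error_term_bound:
  "cmod ((\<Sum>k\<le>N. opt_coeff k / of_nat (m + k + 1)) / of_nat (m + r + 1))
    \<le> real (Suc m) powr (-3/2)"
proof -
  have "cmod ((\<Sum>k\<le>N. opt_coeff k / of_nat (m + k + 1)) / of_nat (m + r + 1))
    \<le> real (Suc m) powr (-1/2) / real (Suc m)"
    unfolding norm_divide norm_of_nat
    by (intro frac_le opt_poly_inner_bound) auto
  also have "\<dots> = real (Suc m) powr (-1/2 - 1)"
    by (subst powr_diff) simp
  finally show ?thesis by simp
qed

theorem theorem3:
  fixes r :: nat
  shows "(\<lambda>n. opt_coeff n * complex_of_real (h_seq r n)) sums (1 / (of_nat r + 1))"
proof -
  \<comment> \<open>As \<open>g\<close> does not depend on \<open>N\<close>, the errors are bounded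
    by tails of one convergent series.\<close>
  define g where "g m = real (Suc m) powr (-3/2)" for m
  let ?S = "\<lambda>N. \<Sum>n\<le>N. opt_coeff n * complex_of_real (h_seq r n)"
  have "summable g"
    unfolding g_def by (subst summable_Suc_iff) (simp add: summable_real_powr_iff)
  have bound: "cmod (?S N - 1 / (of_nat r + 1)) \<le> (\<Sum>j. g (j + Suc N))" for N
  proof -
    let ?e = "\<lambda>j. (\<Sum>k\<le>N. opt_coeff k / of_nat (j + Suc N + k + 1)) / of_nat (j + Suc N + r + 1)"
    have "summable (\<lambda>j. g (j + Suc N))"
      by (rule summable_ignore_initial_segment[OF \<open>summable g\<close>])
    then have "cmod (suminf ?e) \<le> (\<Sum>j. g (j + Suc N))"
      by (rule norm_suminf_le[rotated]) (unfold g_def, rule error_term_bound)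
    then show ?thesis
      using sums_unique[OF partial_sum_error[of N r]] by simp
  qed
  have "(\<lambda>N. \<Sum>j. g (j + Suc N)) \<longlonglongrightarrow> 0"
  proof (rule LIMSEQ_I)
    fix e :: real assume "e > 0"
    from suminf_exist_split[OF this \<open>summable g\<close>]
    obtain K where "\<forall>n\<ge>K. norm (\<Sum>i. g (i + n)) < e" by blast
    then show "\<exists>K. \<forall>N\<ge>K. norm ((\<Sum>j. g (j + Suc N)) - 0) < e"
      by (intro exI[of _ K]) (auto simp del: add_Suc_right)
  qed
  then have "(\<lambda>N. ?S N - 1 / (of_nat r + 1)) \<longlonglongrightarrow> 0"
    by (rule Lim_null_comparison[rotated]) (intro always_eventually allI bound)
  then show ?thesis
    unfolding sums_def_le by (rule LIM_zero_cancel)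
qed

end
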